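(* Let $T$ be a dilation-commuting operator from $S(\mathbb{R}_+)$ to $M(\mathbb{R}_+)$. Suppose $\Phi_1$ and $\Phi_2$ are nonnegative, nondecreasing functions from $\mathbb{R}_+$ onto itself and fix $\gamma\in\mathbb{R}$, $\gamma\neq -1$. Then there exists $C>0$, independent of $f\in S(\mathbb{R}_+)$, such that $$\rho_{\Phi_1,t^{\gamma}}(Tf)\le C\,\rho_{\Phi_2,t^{\gamma}}(f)\qquad\text{for all } f\in S(\mathbb{R}_+)$$ if and only if there exists $K>0$, independent of $f\in S(\mathbb{R}_+)$, such that $$\int_{\mathbb{R}_+}\Phi_1\big(|(Tf)(t)|\big)\,t^{\gamma}\,dt\le K\int_{\mathbb{R}_+}\Phi_2\big(K|f(s)|\big)\,s^{\gamma}\,ds\qquad\text{for all } f\in S(\mathbb{R}_+).$$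
   Context: Here $\mathbb{R}_+=(0,\infty)$; $S(\mathbb{R}_+)$ is the set of simple, Lebesgue-measurable functions on $\mathbb{R}_+$, and $M(\mathbb{R}_+)$ is the class of (real-valued) Lebesgue-measurable functions on $\mathbb{R}_+$. A dilation-commuting operator is a map $T:S(\mathbb{R}_+)\to M(\mathbb{R}_+)$ which is positively homogeneous in the sense that $|T(cf)|=|c|\,|Tf|$ for all $f\in S(\mathbb{R}_+)$, $c\in\mathbb{R}$, and which satisfies $(Tf)(\lambda t)=T(f(\lambda\,\cdot))(t)$ for all $\lambda,t\in\mathbb{R}_+$, $f\in S(\mathbb{R}_+)$. For a nondecreasing function $\Phi$ from $\mathbb{R}_+$ onto itself (with $\Phi(0)=0$) and $f\in M(\mathbb{R}_+)$, the gauge of $f$ is $$\rho_{\Phi,t^{\gamma}}(f)=\inf\Big\{\lambda>0:\int_{\mathbb{R}_+}\Phi\Big(\frac{|f(t)|}{\lambda}\Big)\frac{t^{\gamma}}{\lambda}\,dt\le 1\Big\},$$ with $\inf\emptyset=\infty$. *)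

theory Defs
  imports "HOL-Analysis.Analysis"
begin

text \<open>
  A function on \<open>(0, \<infinity>)\<close> is represented by a total function \<open>real \<Rightarrow> real\<close> of which only the values
  on \<open>{0<..}\<close> matter.
\<close>

abbreviation leb_pos :: "real measure"
  where "leb_pos \<equiv> lebesgue_on {0<..}"

definition simple_pos :: "(real \<Rightarrow> real) set"
  where "simple_pos = {f. simple_function leb_pos f}"

definition meas_pos :: "(real \<Rightarrow> real) set"
  where "meas_pos = borel_measurable leb_pos"

text \<open>
  The condition \<open>cong\<close> says that \<open>T\<close> is well defined as an operator on functions on \<open>(0, \<infinity>)\<close>:
  the values of \<open>T f\<close> there do not depend on the irrelevant values of \<open>f\<close> on \<open>{..0}\<close>.
  Functions are not identified almost everywhere.
\<close>

locale dilation_commuting =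
  fixes T :: "(real \<Rightarrow> real) \<Rightarrow> real \<Rightarrow> real"
  assumes maps_to: "f \<in> simple_pos \<Longrightarrow> T f \<in> meas_pos"
    and cong: "\<lbrakk>f \<in> simple_pos; g \<in> simple_pos; \<And>s. s > 0 \<Longrightarrow> f s = g s; t > 0\<rbrakk> \<Longrightarrow> T f t = T g t"
    and homogeneous: "\<lbrakk>f \<in> simple_pos; t > 0\<rbrakk> \<Longrightarrow> \<bar>T (\<lambda>s. c * f s) t\<bar> = \<bar>c\<bar> * \<bar>T f t\<bar>"
    and dilation: "\<lbrakk>f \<in> simple_pos; r > 0; t > 0\<rbrakk> \<Longrightarrow> T f (r * t) = T (\<lambda>s. f (r * s)) t"

definition gauge_function :: "(real \<Rightarrow> real) \<Rightarrow> bool"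
  where "gauge_function \<Phi> \<longleftrightarrow> \<Phi> 0 = 0 \<and> mono_on {0<..} \<Phi> \<and> \<Phi> ` {0<..} = {0<..}"

text \<open>The infimum is taken in \<^typ>\<open>ennreal\<close>, so that \<open>Inf {} = \<infinity>\<close>.\<close>

definition weighted_gauge :: "(real \<Rightarrow> real) \<Rightarrow> real \<Rightarrow> (real \<Rightarrow> real) \<Rightarrow> ennreal"
  where "weighted_gauge \<Phi> \<gamma> f =
    Inf {ennreal l |l. l > 0 \<and>
      (\<integral>\<^sup>+t. ennreal (\<Phi> (\<bar>f t\<bar> / l) * (t powr \<gamma> / l)) \<partial>leb_pos) \<le> 1}"

end

theory Submission
  imports Defs
begin

text \<open>
  Write \<open>I(f)\<close> for the modular \<open>\<integral> \<Phi>(\<bar>f(t)\<bar>) t\<^sup>\<gamma> dt\<close>. The factor \<open>1/\<lambda>\<close> in the weight makes the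
  condition defining the gauge read \<open>I(f/\<lambda>) \<le> \<lambda>\<close>: the level divides the function and at the same
  time bounds its modular. One constant can therefore do both jobs, as \<open>K\<close> does in the modular
  inequality.

  From the modular inequality to the gauge inequality: if \<open>I\<^sub>2(f/\<lambda>) \<le> \<lambda>\<close>, the modular inequality at
  \<open>f/(K\<lambda>)\<close> and homogeneity of \<open>T\<close> give \<open>I\<^sub>1(Tf/(K\<lambda>)) \<le> K\<lambda>\<close>. Hence \<open>C = K\<close> works.

  Conversely, a gauge inequality only speaks about the level at which \<open>I(f/\<lambda>)\<close> crosses \<open>\<lambda>\<close>, and
  dilations supply the missing freedom. By \<open>modular_dilate\<close>, replacing \<open>f\<close> by \<open>f(r\<cdot>)\<close> divides the
  modular by \<open>r powr (\<gamma> + 1)\<close>, an arbitrary positive factor because \<open>\<gamma> \<noteq> -1\<close>. Put \<open>K = 2C\<close> and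
  let \<open>B > 0\<close> be any real bound for \<open>I\<^sub>2(Kf)\<close>. With \<open>r powr (\<gamma> + 1) = B\<close>, the function \<open>Kf(r\<cdot>)\<close> has
  modular at most 1, hence gauge at most 1, so its image has gauge at most \<open>C < K\<close>, which by
  \<open>modular_le_of_weighted_gauge_less\<close> bounds the modular of \<open>T(f(r\<cdot>)) = (Tf)(r\<cdot>)\<close> by \<open>K\<close>. Undoing
  the dilation gives \<open>I\<^sub>1(Tf) \<le> KB\<close>, and \<open>B\<close> may tend to \<open>I\<^sub>2(Kf)\<close>. Using an upper bound
  \<open>B\<close> instead of \<open>I\<^sub>2(Kf)\<close> itself covers the case where this modular vanishes.
\<close>

section \<open>The modular and the gauge\<close>

definition modular :: "(real \<Rightarrow> real) \<Rightarrow> real \<Rightarrow> (real \<Rightarrow> real) \<Rightarrow> ennreal"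
  where "modular \<Phi> \<gamma> f = (\<integral>\<^sup>+t. ennreal (\<Phi> \<bar>f t\<bar> * t powr \<gamma>) \<partial>leb_pos)"

lemma gauge_function_nonneg:
  assumes "gauge_function \<Phi>" "0 \<le> x"
  shows "0 \<le> \<Phi> x"
proof (cases "x = 0")
  case False
  then have "\<Phi> x \<in> \<Phi> ` {0<..}" using assms by auto
  then show ?thesis using assms unfolding gauge_function_def by auto
qed (use assms in \<open>simp add: gauge_function_def\<close>)

lemma gauge_function_mono:
  assumes "gauge_function \<Phi>" "0 \<le> x" "x \<le> y"
  shows "\<Phi> x \<le> \<Phi> y"
proof (cases "x = 0")
  case True
  then show ?thesis
    using gauge_function_nonneg[OF assms(1), of y] assms by (simp add: gauge_function_def)
next
  case False
  then show ?thesis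
    using assms unfolding gauge_function_def by (auto dest!: mono_onD[of _ _ x y])
qed

lemma borel_measurable_gauge_function_abs:
  assumes "gauge_function \<Phi>" "f \<in> borel_measurable M"
  shows "(\<lambda>t. \<Phi> \<bar>f t\<bar>) \<in> borel_measurable M"
proof -
  \<comment> \<open>\<open>\<Phi>\<close> is arbitrary on the negative axis; extended by 0 it is monotone on the whole line.\<close>
  have "mono (\<lambda>x. \<Phi> (max 0 x))"
    by (auto intro!: monoI gauge_function_mono[OF assms(1)])
  then have [measurable]: "(\<lambda>x. \<Phi> (max 0 x)) \<in> borel_measurable borel"
    by (rule borel_measurable_mono)
  note [measurable] = assms(2)
  have "(\<lambda>t. \<Phi> (max 0 \<bar>f t\<bar>)) \<in> borel_measurable M"
    by measurable
  then show ?thesis by simp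
qed

lemma powr_measurable_leb_pos: "(\<lambda>t. t powr \<gamma>) \<in> borel_measurable leb_pos"
proof -
  have "(\<lambda>t::real. t powr \<gamma>) \<in> borel_measurable borel" by measurable
  then show ?thesis
    by (intro measurable_restrict_space1 measurable_completion) simp
qed

lemma modular_integrand_measurable:
  assumes "gauge_function \<Phi>" "f \<in> borel_measurable leb_pos"
  shows "(\<lambda>t. ennreal (\<Phi> \<bar>f t\<bar> * t powr \<gamma>)) \<in> borel_measurable leb_pos"
  by (intro measurable_compose[OF _ measurable_ennreal] borel_measurable_times
      borel_measurable_gauge_function_abs[OF assms] powr_measurable_leb_pos)

lemma modular_mono:
  assumes "gauge_function \<Phi>" "\<And>t. t > 0 \<Longrightarrow> \<bar>f t\<bar> \<le> \<bar>g t\<bar>"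
  shows "modular \<Phi> \<gamma> f \<le> modular \<Phi> \<gamma> g"
  unfolding modular_def
  by (intro nn_integral_mono ennreal_leI mult_right_mono gauge_function_mono[OF assms(1)])
     (auto simp: assms(2))

lemma modular_cong_abs:
  assumes "\<And>t. t > 0 \<Longrightarrow> \<bar>f t\<bar> = \<bar>g t\<bar>"
  shows "modular \<Phi> \<gamma> f = modular \<Phi> \<gamma> g"
  unfolding modular_def by (intro nn_integral_cong) (simp add: assms)

lemma weighted_gauge_eq_Inf_modular:
  assumes "gauge_function \<Phi>" "f \<in> borel_measurable leb_pos"
  shows "weighted_gauge \<Phi> \<gamma> f =
    Inf {ennreal l |l. l > 0 \<and> modular \<Phi> \<gamma> (\<lambda>t. f t / l) \<le> ennreal l}"
proof -
  have "(\<integral>\<^sup>+t. ennreal (\<Phi> (\<bar>f t\<bar> / l) * (t powr \<gamma> / l)) \<partial>leb_pos) \<le> 1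
      \<longleftrightarrow> modular \<Phi> \<gamma> (\<lambda>t. f t / l) \<le> ennreal l" if l: "l > 0" for l
  proof -
    have meas: "(\<lambda>t. f t / l) \<in> borel_measurable leb_pos"
      using assms(2) by measurable
    have "(\<integral>\<^sup>+t. ennreal (\<Phi> (\<bar>f t\<bar> / l) * (t powr \<gamma> / l)) \<partial>leb_pos)
        = (\<integral>\<^sup>+t. ennreal (\<Phi> \<bar>f t / l\<bar> * t powr \<gamma>) / ennreal l \<partial>leb_pos)"
      using l by (intro nn_integral_cong)
        (auto simp: divide_ennreal gauge_function_nonneg[OF assms(1)])
    also have "\<dots> = modular \<Phi> \<gamma> (\<lambda>t. f t / l) / ennreal l"
      unfolding modular_def
      by (intro nn_integral_divide modular_integrand_measurable assms meas)
    finally show ?thesis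
      using l by (cases "modular \<Phi> \<gamma> (\<lambda>t. f t / l)")
        (auto simp: divide_ennreal ennreal_top_divide top_unique simp flip: ennreal_1)
  qed
  then show ?thesis
    unfolding weighted_gauge_def by (intro arg_cong[where f = Inf]) blast
qed

lemma weighted_gauge_le:
  assumes "gauge_function \<Phi>" "f \<in> borel_measurable leb_pos" "l > 0"
    and "modular \<Phi> \<gamma> (\<lambda>t. f t / l) \<le> ennreal l"
  shows "weighted_gauge \<Phi> \<gamma> f \<le> ennreal l"
  unfolding weighted_gauge_eq_Inf_modular[OF assms(1,2)] using assms(3,4) by (intro Inf_lower) auto

text \<open>
  The admissible levels form an up-set: as the level grows, \<open>f/l\<close> decreases and the bound \<open>l\<close>
  increases. The strict inequality in the hypothesis provides an admissible level below \<open>c\<close>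
  without raising the question whether the infimum is attained.
\<close>

lemma modular_le_of_weighted_gauge_less:
  assumes "gauge_function \<Phi>" "f \<in> borel_measurable leb_pos"
    and "weighted_gauge \<Phi> \<gamma> f < ennreal c"
  shows "modular \<Phi> \<gamma> (\<lambda>t. f t / c) \<le> ennreal c"
proof -
  obtain l where l: "l > 0" "modular \<Phi> \<gamma> (\<lambda>t. f t / l) \<le> ennreal l" "ennreal l < ennreal c"
    using assms(3) unfolding weighted_gauge_eq_Inf_modular[OF assms(1,2)] Inf_less_iff by blast
  then have "l < c" by (simp add: ennreal_less_iff)
  with l(1) have "modular \<Phi> \<gamma> (\<lambda>t. f t / c) \<le> modular \<Phi> \<gamma> (\<lambda>t. f t / l)"
    by (intro modular_mono assms(1)) (auto intro!: divide_left_mono)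
  also note l(2)
  also have "ennreal l \<le> ennreal c" using l(3) by simp
  finally show ?thesis .
qed

section \<open>Dilations\<close>

lemma dilation_measurable_lebesgue: "(\<lambda>t::real. r * t) \<in> lebesgue \<rightarrow>\<^sub>M lebesgue"
proof -
  have "(*\<^sub>R) r = (\<lambda>t::real. r * t)" by (simp add: fun_eq_iff)
  then show ?thesis using lebesgue_measurable_scaling[of r, where 'a = real] by simp
qed

lemma dilation_measurable_leb_pos:
  assumes "r > (0::real)"
  shows "(\<lambda>t. r * t) \<in> leb_pos \<rightarrow>\<^sub>M leb_pos"
  using assms by (intro measurable_restrict_space3 dilation_measurable_lebesgue) auto

lemma nn_integral_dilation_leb_pos:
  assumes "F \<in> borel_measurable leb_pos" "r > (0::real)"
  shows "(\<integral>\<^sup>+t. F t \<partial>leb_pos) = ennreal r * (\<integral>\<^sup>+t. F (r * t) \<partial>leb_pos)"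
proof -
  let ?G = "\<lambda>t. F t * indicator {0<..} t"
  have G: "?G \<in> borel_measurable lebesgue"
    using assms(1) by (subst (asm) borel_measurable_restrict_space_iff_ennreal) auto
  have "(\<integral>\<^sup>+t. F t \<partial>leb_pos) = (\<integral>\<^sup>+t. ?G t \<partial>lebesgue)"
    by (simp add: nn_integral_restrict_space)
  also have "\<dots> = (\<integral>\<^sup>+t. ?G t \<partial>density (distr lebesgue lebesgue (\<lambda>t. r * t)) (\<lambda>_. ennreal \<bar>r\<bar>))"
    using lebesgue_real_scale[of r] assms(2) by simp
  also have "\<dots> = (\<integral>\<^sup>+t. ennreal r * ?G t \<partial>distr lebesgue lebesgue (\<lambda>t. r * t))"
    using G assms(2) by (subst nn_integral_density) auto
  also have "\<dots> = ennreal r * (\<integral>\<^sup>+t. ?G t \<partial>distr lebesgue lebesgue (\<lambda>t. r * t))"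
    using G by (intro nn_integral_cmult) simp
  also have "\<dots> = ennreal r * (\<integral>\<^sup>+t. ?G (r * t) \<partial>lebesgue)"
    using G by (subst nn_integral_distr[OF dilation_measurable_lebesgue]) auto
  also have "(\<integral>\<^sup>+t. ?G (r * t) \<partial>lebesgue) = (\<integral>\<^sup>+t. F (r * t) \<partial>leb_pos)"
    using assms(2) by (subst nn_integral_restrict_space)
      (auto intro!: nn_integral_cong simp: indicator_def zero_less_mult_iff)
  finally show ?thesis .
qed

lemma modular_dilate:
  assumes "gauge_function \<Phi>" "f \<in> borel_measurable leb_pos" "r > 0"
  shows "modular \<Phi> \<gamma> f = ennreal (r powr (\<gamma> + 1)) * modular \<Phi> \<gamma> (\<lambda>t. f (r * t))"
proof -
  have meas: "(\<lambda>t. f (r * t)) \<in> borel_measurable leb_pos"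
    using measurable_compose[OF dilation_measurable_leb_pos[OF assms(3)] assms(2)] by simp
  have "modular \<Phi> \<gamma> f
      = ennreal r * (\<integral>\<^sup>+t. ennreal (\<Phi> \<bar>f (r * t)\<bar> * (r * t) powr \<gamma>) \<partial>leb_pos)"
    unfolding modular_def
    by (intro nn_integral_dilation_leb_pos modular_integrand_measurable assms)
  also have "(\<integral>\<^sup>+t. ennreal (\<Phi> \<bar>f (r * t)\<bar> * (r * t) powr \<gamma>) \<partial>leb_pos)
      = (\<integral>\<^sup>+t. ennreal (r powr \<gamma>) * ennreal (\<Phi> \<bar>f (r * t)\<bar> * t powr \<gamma>) \<partial>leb_pos)"
    using assms(3) by (intro nn_integral_cong)
      (auto simp: powr_mult ennreal_mult'[symmetric] mult_ac)
  also have "\<dots> = ennreal (r powr \<gamma>) * modular \<Phi> \<gamma> (\<lambda>t. f (r * t))"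
    unfolding modular_def
    by (intro nn_integral_cmult modular_integrand_measurable assms(1) meas)
  finally show ?thesis
    using assms(3) by (simp add: powr_add ennreal_mult' mult_ac)
qed

lemma simple_pos_measurable: "f \<in> simple_pos \<Longrightarrow> f \<in> borel_measurable leb_pos"
  unfolding simple_pos_def by (auto intro: borel_measurable_simple_function)

lemma simple_pos_scale: "f \<in> simple_pos \<Longrightarrow> (\<lambda>t. c * f t) \<in> simple_pos"
  unfolding simple_pos_def by (auto intro: simple_function_compose1)

lemma simple_pos_dilate:
  assumes "f \<in> simple_pos" "r > 0"
  shows "(\<lambda>t. f (r * t)) \<in> simple_pos"
  using simple_function_comp[OF dilation_measurable_leb_pos[OF assms(2)], of f] assms(1)
  unfolding simple_pos_def by simp

section \<open>Gauge inequalities and modular inequalities\<close>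

lemma gauge_inequality_of_modular_inequality:
  assumes T: "dilation_commuting T" and \<Phi>: "gauge_function \<Phi>\<^sub>1" "gauge_function \<Phi>\<^sub>2"
    and K: "K > 0"
    and le: "\<And>f. f \<in> simple_pos \<Longrightarrow>
      modular \<Phi>\<^sub>1 \<gamma> (T f) \<le> ennreal K * modular \<Phi>\<^sub>2 \<gamma> (\<lambda>s. K * f s)"
    and f: "f \<in> simple_pos"
  shows "weighted_gauge \<Phi>\<^sub>1 \<gamma> (T f) \<le> ennreal K * weighted_gauge \<Phi>\<^sub>2 \<gamma> f"
proof -
  interpret dilation_commuting T by (rule T)
  have Tf: "T f \<in> borel_measurable leb_pos"
    using maps_to[OF f] by (simp add: meas_pos_def)
  have "weighted_gauge \<Phi>\<^sub>1 \<gamma> (T f) \<le> ennreal K * ennreal l"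
    if l: "l > 0" "modular \<Phi>\<^sub>2 \<gamma> (\<lambda>t. f t / l) \<le> ennreal l" for l
  proof -
    let ?c = "1 / (K * l)"
    have "modular \<Phi>\<^sub>1 \<gamma> (\<lambda>t. T f t / (K * l)) = modular \<Phi>\<^sub>1 \<gamma> (T (\<lambda>s. ?c * f s))"
      by (intro modular_cong_abs) (subst homogeneous[OF f]; simp add: abs_mult)
    also have "\<dots> \<le> ennreal K * modular \<Phi>\<^sub>2 \<gamma> (\<lambda>s. K * (?c * f s))"
      by (intro le simple_pos_scale f)
    also have "(\<lambda>s. K * (?c * f s)) = (\<lambda>s. f s / l)"
      using K by auto
    also have "ennreal K * modular \<Phi>\<^sub>2 \<gamma> (\<lambda>s. f s / l) \<le> ennreal K * ennreal l"
      using l(2) by (intro mult_left_mono) auto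
    also have "\<dots> = ennreal (K * l)"
      using K l(1) by (simp add: ennreal_mult)
    finally have "weighted_gauge \<Phi>\<^sub>1 \<gamma> (T f) \<le> ennreal (K * l)"
      using K l(1) by (intro weighted_gauge_le \<Phi> Tf) auto
    then show ?thesis using K l(1) by (simp add: ennreal_mult)
  qed
  \<comment> \<open>Dividing by \<open>K\<close> moves the bound inside the infimum, also when no level is admissible.\<close>
  then have "weighted_gauge \<Phi>\<^sub>1 \<gamma> (T f) / ennreal K \<le> weighted_gauge \<Phi>\<^sub>2 \<gamma> f"
    unfolding weighted_gauge_eq_Inf_modular[OF \<Phi>(2) simple_pos_measurable[OF f]]
    using K by (intro Inf_greatest) (auto intro!: divide_le_posI_ennreal simp: mult.commute)
  then have "ennreal K * (weighted_gauge \<Phi>\<^sub>1 \<gamma> (T f) / ennreal K)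
      \<le> ennreal K * weighted_gauge \<Phi>\<^sub>2 \<gamma> f"
    by (intro mult_left_mono) auto
  then show ?thesis
    using K by (simp add: ennreal_times_divide mult.commute[of "ennreal K" "weighted_gauge \<Phi>\<^sub>1 \<gamma> (T f)"]
        ennreal_mult_divide_eq)
qed

lemma modular_inequality_of_gauge_inequality:
  assumes T: "dilation_commuting T" and \<Phi>: "gauge_function \<Phi>\<^sub>1" "gauge_function \<Phi>\<^sub>2"
    and \<gamma>: "\<gamma> \<noteq> -1" and C: "C > 0"
    and le: "\<And>f. f \<in> simple_pos \<Longrightarrow>
      weighted_gauge \<Phi>\<^sub>1 \<gamma> (T f) \<le> ennreal C * weighted_gauge \<Phi>\<^sub>2 \<gamma> f"
    and f: "f \<in> simple_pos"
  shows "modular \<Phi>\<^sub>1 \<gamma> (T f) \<le> ennreal (2 * C) * modular \<Phi>\<^sub>2 \<gamma> (\<lambda>s. 2 * C * f s)"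
proof -
  interpret dilation_commuting T by (rule T)
  define K where "K = 2 * C"
  have K: "K > 0" "C < K" using C by (auto simp: K_def)
  let ?A = "modular \<Phi>\<^sub>2 \<gamma> (\<lambda>s. K * f s)"
  have Tf: "T f \<in> borel_measurable leb_pos"
    using maps_to[OF f] by (simp add: meas_pos_def)
  have bound: "modular \<Phi>\<^sub>1 \<gamma> (T f) \<le> ennreal (K * B)" if B: "B > 0" "?A \<le> ennreal B" for B
  proof -
    define r where "r = B powr (1 / (\<gamma> + 1))"
    have r: "r > 0" "r powr (\<gamma> + 1) = B"
      using B(1) \<gamma> by (auto simp: r_def powr_powr)
    let ?g = "\<lambda>s. f (r * s)"
    have g: "?g \<in> simple_pos" by (rule simple_pos_dilate[OF f r(1)])
    have Kg: "(\<lambda>s. K * ?g s) \<in> simple_pos" by (rule simple_pos_scale[OF g])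
    have TKg: "T (\<lambda>s. K * ?g s) \<in> borel_measurable leb_pos"
      using maps_to[OF Kg] by (simp add: meas_pos_def)
    have "ennreal B * modular \<Phi>\<^sub>2 \<gamma> (\<lambda>s. K * ?g s) \<le> ennreal B * 1"
      using modular_dilate[OF \<Phi>(2) simple_pos_measurable[OF simple_pos_scale[OF f]] r(1), of \<gamma> K] B(2)
      by (simp add: r(2))
    then have "modular \<Phi>\<^sub>2 \<gamma> (\<lambda>s. K * ?g s) \<le> 1"
      using B(1) by (subst (asm) ennreal_mult_le_mult_iff) auto
    then have "weighted_gauge \<Phi>\<^sub>2 \<gamma> (\<lambda>s. K * ?g s) \<le> ennreal 1"
      by (intro weighted_gauge_le \<Phi> simple_pos_measurable Kg) auto
    then have "ennreal C * weighted_gauge \<Phi>\<^sub>2 \<gamma> (\<lambda>s. K * ?g s) \<le> ennreal C * 1"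
      by (intro mult_left_mono) auto
    with le[OF Kg] have "weighted_gauge \<Phi>\<^sub>1 \<gamma> (T (\<lambda>s. K * ?g s)) \<le> ennreal C"
      by simp
    also have "ennreal C < ennreal K" using C K by (simp add: ennreal_less_iff)
    finally have "modular \<Phi>\<^sub>1 \<gamma> (\<lambda>t. T (\<lambda>s. K * ?g s) t / K) \<le> ennreal K"
      by (rule modular_le_of_weighted_gauge_less[OF \<Phi>(1) TKg])
    also have "modular \<Phi>\<^sub>1 \<gamma> (\<lambda>t. T (\<lambda>s. K * ?g s) t / K) = modular \<Phi>\<^sub>1 \<gamma> (\<lambda>t. T f (r * t))"
      using K by (intro modular_cong_abs)
        (simp add: homogeneous[OF g] dilation[OF f r(1)] abs_divide)
    finally have "ennreal B * modular \<Phi>\<^sub>1 \<gamma> (\<lambda>t. T f (r * t)) \<le> ennreal B * ennreal K"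
      by (intro mult_left_mono) auto
    then show ?thesis
      using modular_dilate[OF \<Phi>(1) Tf r(1), of \<gamma>] r(2) B(1) K
      by (simp add: ennreal_mult mult.commute)
  qed
  have "modular \<Phi>\<^sub>1 \<gamma> (T f) \<le> ennreal K * ?A"
  proof (cases ?A)
    case top
    then show ?thesis using K by (simp add: ennreal_mult_top)
  next
    case (real a)
    have "modular \<Phi>\<^sub>1 \<gamma> (T f) \<le> ennreal (K * a)"
    proof (rule ennreal_le_epsilon)
      fix e :: real assume e: "e > 0"
      \<comment> \<open>The choice \<open>B = a + e / K\<close> is positive even for \<open>a = 0\<close>, and \<open>K * B = K * a + e\<close>.\<close>
      have "modular \<Phi>\<^sub>1 \<gamma> (T f) \<le> ennreal (K * (a + e / K))"
        using real e K by (intro bound) (auto intro: add_nonneg_pos)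
      also have "K * (a + e / K) = K * a + e" using K by (simp add: field_simps)
      also have "ennreal (K * a + e) = ennreal (K * a) + ennreal e"
        using real e K by (simp add: ennreal_plus)
      finally show "modular \<Phi>\<^sub>1 \<gamma> (T f) \<le> ennreal (K * a) + ennreal e" .
    qed
    then show ?thesis using real K by (simp add: ennreal_mult)
  qed
  then show ?thesis by (simp add: K_def)
qed

theorem theorem1:
  fixes T :: "(real \<Rightarrow> real) \<Rightarrow> real \<Rightarrow> real"
    and \<Phi>\<^sub>1 \<Phi>\<^sub>2 :: "real \<Rightarrow> real"
    and \<gamma> :: real
  assumes "dilation_commuting T"
    and "gauge_function \<Phi>\<^sub>1"
    and "gauge_function \<Phi>\<^sub>2"
    and "\<gamma> \<noteq> -1"
  shows "(\<exists>C::real. C > 0 \<and>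
            (\<forall>f\<in>simple_pos. weighted_gauge \<Phi>\<^sub>1 \<gamma> (T f) \<le> ennreal C * weighted_gauge \<Phi>\<^sub>2 \<gamma> f))
     \<longleftrightarrow> (\<exists>K::real. K > 0 \<and>
            (\<forall>f\<in>simple_pos.
              (\<integral>\<^sup>+t. ennreal (\<Phi>\<^sub>1 \<bar>T f t\<bar> * t powr \<gamma>) \<partial>leb_pos)
                \<le> ennreal K * (\<integral>\<^sup>+s. ennreal (\<Phi>\<^sub>2 (K * \<bar>f s\<bar>) * s powr \<gamma>) \<partial>leb_pos)))"
    (is "(\<exists>C. C > 0 \<and> ?gauge C) \<longleftrightarrow> (\<exists>K. K > 0 \<and> ?mod K)")
proof -
  have mod_iff: "?mod K \<longleftrightarrow> (\<forall>f\<in>simple_pos. modular \<Phi>\<^sub>1 \<gamma> (T f)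
      \<le> ennreal K * modular \<Phi>\<^sub>2 \<gamma> (\<lambda>s. K * f s))" if "K > 0" for K
    using that by (simp add: modular_def abs_mult)
  show ?thesis
  proof
    assume "\<exists>C. C > 0 \<and> ?gauge C"
    then obtain C where C: "C > 0" "?gauge C" by blast
    then have "?mod (2 * C)"
      unfolding mod_iff[of "2 * C", OF mult_pos_pos[OF zero_less_numeral C(1)]]
      using modular_inequality_of_gauge_inequality[OF assms C(1)] by blast
    then show "\<exists>K. K > 0 \<and> ?mod K"
      using C(1) by (intro exI[of _ "2 * C"]) simp
  next
    assume "\<exists>K. K > 0 \<and> ?mod K"
    then obtain K where K: "K > 0" "?mod K" by blast
    then show "\<exists>C. C > 0 \<and> ?gauge C"
      using gauge_inequality_of_modular_inequality[OF assms(1-3) K(1)]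
      unfolding mod_iff[OF K(1)] by blast
  qed
qed

end
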